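(* (Binet's formula.) Let $\alpha=1+\sqrt2$, $\beta=1-\sqrt2$, $\hat\alpha=1+i\,\alpha+j\,\alpha^2+ij\,\alpha^3$ and $\hat\beta=1+i\,\beta+j\,\beta^2+ij\,\beta^3$. For every integer $n\ge 1$, $$BP_n=\frac{1}{\alpha-\beta}\left(\hat\alpha\,\alpha^n-\hat\beta\,\beta^n\right)$$ and $$BPL_n=\hat\alpha\,\alpha^n+\hat\beta\,\beta^n.$$
   Context: The bicomplex numbers $\mathbb{C}_2=\{q_1+iq_2+jq_3+ijq_4 : q_1,q_2,q_3,q_4\in\mathbb{R}\}$ form the commutative associative real algebra with basis $1,i,j,ij$ and multiplication determined by $i^2=-1$, $j^2=-1$, $ij=ji$ (so $(ij)^2=1$). The Pell numbers are given by $P_0=0$, $P_1=1$, $P_n=2P_{n-1}+P_{n-2}$ and the Pell-Lucas numbers by $Q_0=2$, $Q_1=2$, $Q_n=2Q_{n-1}+Q_{n-2}$. The bicomplex Pell and bicomplex Pell-Lucas numbers are $BP_n=P_n+iP_{n+1}+jP_{n+2}+ijP_{n+3}$ and $BPL_n=Q_n+iQ_{n+1}+jQ_{n+2}+ijQ_{n+3}$. *)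

theory Defs
  imports Complex_Main
begin

text \<open>\<open>Bicomplex a b c d\<close> stands for \<open>a + i b + j c + ij d\<close>; see \<open>bicomplex_eq\<close> below.\<close>

datatype bicomplex = Bicomplex (q1: real) (q2: real) (q3: real) (q4: real)

lemma bicomplex_eq_iff:
  "x = y \<longleftrightarrow> q1 x = q1 y \<and> q2 x = q2 y \<and> q3 x = q3 y \<and> q4 x = q4 y"
  by (auto intro: bicomplex.expand)

instantiation bicomplex :: "{comm_ring_1, real_algebra_1}"
begin

definition zero_bicomplex :: bicomplex where
  "0 = Bicomplex 0 0 0 0"

definition one_bicomplex :: bicomplex where
  "1 = Bicomplex 1 0 0 0"

definition uminus_bicomplex :: "bicomplex \<Rightarrow> bicomplex" where
  "- x = Bicomplex (- q1 x) (- q2 x) (- q3 x) (- q4 x)"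

definition plus_bicomplex :: "bicomplex \<Rightarrow> bicomplex \<Rightarrow> bicomplex" where
  "x + y = Bicomplex (q1 x + q1 y) (q2 x + q2 y) (q3 x + q3 y) (q4 x + q4 y)"

definition minus_bicomplex :: "bicomplex \<Rightarrow> bicomplex \<Rightarrow> bicomplex" where
  "x - y = Bicomplex (q1 x - q1 y) (q2 x - q2 y) (q3 x - q3 y) (q4 x - q4 y)"

definition scaleR_bicomplex :: "real \<Rightarrow> bicomplex \<Rightarrow> bicomplex" where
  "r *\<^sub>R x = Bicomplex (r * q1 x) (r * q2 x) (r * q3 x) (r * q4 x)"

text \<open>The bilinear extension of \<open>i\<^sup>2 = j\<^sup>2 = -1\<close>, \<open>ij = ji\<close>; in particular
  \<open>(ij)\<^sup>2 = 1\<close>, \<open>i (ij) = -j\<close> and \<open>j (ij) = -i\<close>.\<close>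

definition times_bicomplex :: "bicomplex \<Rightarrow> bicomplex \<Rightarrow> bicomplex" where
  "x * y = Bicomplex
     (q1 x * q1 y - q2 x * q2 y - q3 x * q3 y + q4 x * q4 y)
     (q1 x * q2 y + q2 x * q1 y - q3 x * q4 y - q4 x * q3 y)
     (q1 x * q3 y + q3 x * q1 y - q2 x * q4 y - q4 x * q2 y)
     (q1 x * q4 y + q4 x * q1 y + q2 x * q3 y + q3 x * q2 y)"

instance
  by standard
    (simp_all add: bicomplex_eq_iff zero_bicomplex_def one_bicomplex_def uminus_bicomplex_def
      plus_bicomplex_def minus_bicomplex_def scaleR_bicomplex_def times_bicomplex_def
      algebra_simps)

end

definition bi :: bicomplex where "bi = Bicomplex 0 1 0 0"

definition bj :: bicomplex where "bj = Bicomplex 0 0 1 0"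

lemma bi_squared: "bi\<^sup>2 = - 1"
  and bj_squared: "bj\<^sup>2 = - 1"
  and bi_bj_squared: "(bi * bj)\<^sup>2 = 1"
  by (simp_all add: power2_eq_square bi_def bj_def bicomplex_eq_iff times_bicomplex_def
      one_bicomplex_def uminus_bicomplex_def)

lemma bicomplex_eq:
  "Bicomplex a b c d = of_real a + bi * of_real b + bj * of_real c + bi * bj * of_real d"
  by (simp add: of_real_def bi_def bj_def bicomplex_eq_iff times_bicomplex_def
      plus_bicomplex_def scaleR_bicomplex_def one_bicomplex_def)

fun pell :: "nat \<Rightarrow> nat" where
  "pell 0 = 0"
| "pell (Suc 0) = 1"
| "pell (Suc (Suc n)) = 2 * pell (Suc n) + pell n"

fun pell_lucas :: "nat \<Rightarrow> nat" where
  "pell_lucas 0 = 2"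
| "pell_lucas (Suc 0) = 2"
| "pell_lucas (Suc (Suc n)) = 2 * pell_lucas (Suc n) + pell_lucas n"

definition BP :: "nat \<Rightarrow> bicomplex" where
  "BP n = of_nat (pell n) + bi * of_nat (pell (n + 1)) + bj * of_nat (pell (n + 2))
          + bi * bj * of_nat (pell (n + 3))"

definition BPL :: "nat \<Rightarrow> bicomplex" where
  "BPL n = of_nat (pell_lucas n) + bi * of_nat (pell_lucas (n + 1))
           + bj * of_nat (pell_lucas (n + 2)) + bi * bj * of_nat (pell_lucas (n + 3))"

end

theory Submission
  imports Defs
begin

text \<open>Binet's formula holds componentwise. The reals \<open>\<alpha>\<close> and \<open>\<beta>\<close> are the roots of
  \<open>x\<^sup>2 = 2x + 1\<close>, the characteristic equation of the recurrence that both sequences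
  satisfy, so the scalar formulas \<open>(\<alpha> - \<beta>) P\<^sub>n = \<alpha>\<^sup>n - \<beta>\<^sup>n\<close> and \<open>Q\<^sub>n = \<alpha>\<^sup>n + \<beta>\<^sup>n\<close>
  need only be compared at \<open>n = 0\<close> and \<open>n = 1\<close> (\<open>pell_Binet\<close>, \<open>pell_lucas_Binet\<close>).

  The bicomplex statement follows by linearity. Assigning to a real sequence \<open>u\<close> the
  bicomplex number \<open>u\<^sub>n + i u\<^sub>n\<^sub>+\<^sub>1 + j u\<^sub>n\<^sub>+\<^sub>2 + ij u\<^sub>n\<^sub>+\<^sub>3\<close> is real-linear in \<open>u\<close>, and it takes
  the geometric sequence with ratio \<open>x\<close> to \<open>(1 + i x + j x\<^sup>2 + ij x\<^sup>3) x\<^sup>n\<close>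
  (\<open>bicomplex_window_geometric\<close>). For \<open>x = \<alpha>\<close> and \<open>x = \<beta>\<close> the first factors are
  \<open>\<alpha>\<close>-hat and \<open>\<beta>\<close>-hat.\<close>

lemma silver_ratio_root: "(1 + sqrt 2)\<^sup>2 = 2 * (1 + sqrt 2) + 1"
  and silver_ratio_conjugate_root: "(1 - sqrt 2)\<^sup>2 = 2 * (1 - sqrt 2) + 1"
  by (simp_all add: power2_eq_square algebra_simps)

lemma power_Suc_Suc_of_root:
  fixes x :: real
  assumes "x\<^sup>2 = 2 * x + 1"
  shows "x ^ Suc (Suc n) = 2 * x ^ Suc n + x ^ n"
proof -
  have "x ^ Suc (Suc n) = x\<^sup>2 * x ^ n"
    by (simp add: power2_eq_square)
  then show ?thesis
    by (simp add: assms algebra_simps)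
qed

lemma pell_Binet:
  fixes x y :: real
  assumes "x\<^sup>2 = 2 * x + 1" and "y\<^sup>2 = 2 * y + 1"
  shows "(x - y) * real (pell n) = x ^ n - y ^ n"
proof (induction n rule: pell.induct)
  case (3 n)
  have "(x - y) * real (pell (Suc (Suc n)))
      = 2 * ((x - y) * real (pell (Suc n))) + (x - y) * real (pell n)"
    by (simp add: algebra_simps)
  also have "\<dots> = x ^ Suc (Suc n) - y ^ Suc (Suc n)"
    unfolding 3 power_Suc_Suc_of_root[OF assms(1)] power_Suc_Suc_of_root[OF assms(2)]
    by simp
  finally show ?case .
qed simp_all

text \<open>The sum \<open>x + y\<close> has to be \<open>Q\<^sub>1 = 2\<close>, which forces \<open>x\<close> and \<open>y\<close> to be the two different
  roots.\<close>

lemma pell_lucas_Binet: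
  fixes x y :: real
  assumes "x\<^sup>2 = 2 * x + 1" and "y\<^sup>2 = 2 * y + 1" and "x + y = 2"
  shows "real (pell_lucas n) = x ^ n + y ^ n"
proof (induction n rule: pell_lucas.induct)
  case (3 n)
  have "real (pell_lucas (Suc (Suc n)))
      = 2 * real (pell_lucas (Suc n)) + real (pell_lucas n)"
    by simp
  also have "\<dots> = x ^ Suc (Suc n) + y ^ Suc (Suc n)"
    unfolding 3 power_Suc_Suc_of_root[OF assms(1)] power_Suc_Suc_of_root[OF assms(2)]
    by simp
  finally show ?case .
qed (use assms(3) in simp_all)

definition bicomplex_window :: "(nat \<Rightarrow> real) \<Rightarrow> nat \<Rightarrow> bicomplex" where
  "bicomplex_window u n = of_real (u n) + bi * of_real (u (n + 1)) + bj * of_real (u (n + 2))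
     + bi * bj * of_real (u (n + 3))"

lemma BP_eq_window: "BP n = bicomplex_window (\<lambda>k. real (pell k)) n"
  by (simp add: BP_def bicomplex_window_def)

lemma BPL_eq_window: "BPL n = bicomplex_window (\<lambda>k. real (pell_lucas k)) n"
  by (simp add: BPL_def bicomplex_window_def)

lemma bicomplex_window_add:
  "bicomplex_window (\<lambda>k. u k + v k) n = bicomplex_window u n + bicomplex_window v n"
  by (simp add: bicomplex_window_def algebra_simps)

lemma bicomplex_window_diff:
  "bicomplex_window (\<lambda>k. u k - v k) n = bicomplex_window u n - bicomplex_window v n"
  by (simp add: bicomplex_window_def algebra_simps)

lemma bicomplex_window_scaleR:
  "bicomplex_window (\<lambda>k. c * u k) n = c *\<^sub>R bicomplex_window u n"
  by (simp add: bicomplex_window_def scaleR_conv_of_real algebra_simps)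

text \<open>Shifting a geometric sequence multiplies it by a power of its ratio, so \<open>x ^ n\<close> is a
  common factor of all four components.\<close>

lemma bicomplex_window_geometric:
  "bicomplex_window (\<lambda>k. x ^ k) n
     = (1 + bi * of_real x + bj * of_real (x ^ 2) + bi * bj * of_real (x ^ 3)) * of_real (x ^ n)"
  by (simp add: bicomplex_window_def power_add power2_eq_square algebra_simps)

theorem theorem2p7:
  fixes \<alpha> \<beta> :: real and \<alpha>hat \<beta>hat :: bicomplex and n :: nat
  assumes "\<alpha> = 1 + sqrt 2" and "\<beta> = 1 - sqrt 2"
    and "\<alpha>hat = 1 + bi * of_real \<alpha> + bj * of_real (\<alpha> ^ 2) + bi * bj * of_real (\<alpha> ^ 3)"
    and "\<beta>hat = 1 + bi * of_real \<beta> + bj * of_real (\<beta> ^ 2) + bi * bj * of_real (\<beta> ^ 3)"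
    and "n \<ge> 1"
  shows "BP n = (1 / (\<alpha> - \<beta>)) *\<^sub>R (\<alpha>hat * of_real (\<alpha> ^ n) - \<beta>hat * of_real (\<beta> ^ n))
       \<and> BPL n = \<alpha>hat * of_real (\<alpha> ^ n) + \<beta>hat * of_real (\<beta> ^ n)"
proof
  have roots: "\<alpha>\<^sup>2 = 2 * \<alpha> + 1" "\<beta>\<^sup>2 = 2 * \<beta> + 1"
    using silver_ratio_root silver_ratio_conjugate_root by (simp_all only: assms(1,2))
  have "\<alpha> - \<beta> \<noteq> 0" and sum: "\<alpha> + \<beta> = 2"
    by (simp_all add: assms(1,2))
  then have pell: "real (pell k) = (1 / (\<alpha> - \<beta>)) * (\<alpha> ^ k - \<beta> ^ k)" for k
    using pell_Binet[OF roots, of k] by (simp add: field_simps)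
  note window = bicomplex_window_geometric[of \<alpha> n, folded assms(3)]
    bicomplex_window_geometric[of \<beta> n, folded assms(4)]
  show "BP n = (1 / (\<alpha> - \<beta>)) *\<^sub>R (\<alpha>hat * of_real (\<alpha> ^ n) - \<beta>hat * of_real (\<beta> ^ n))"
    unfolding BP_eq_window pell bicomplex_window_scaleR bicomplex_window_diff window ..
  show "BPL n = \<alpha>hat * of_real (\<alpha> ^ n) + \<beta>hat * of_real (\<beta> ^ n)"
    unfolding BPL_eq_window pell_lucas_Binet[OF roots sum] bicomplex_window_add window ..
qed

end
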